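(* Let $a\in\mathbb{Z}$ and let $\alpha$ be a root of $X^3-(a-1)X^2-(a+2)X-1$. Then $\omega(\mathbb{Z}[\alpha])\leq 2$, i.e. every nonzero element of $\mathbb{Z}[\alpha]$ can be written as $a_1\nu_1+\dots+a_\ell\nu_\ell$ with pairwise distinct units $\nu_1,\dots,\nu_\ell\in\mathbb{Z}[\alpha]^*$ and coefficients $a_i\in\{1,2\}$.
   Context: For an order $\mathcal{O}$ of a number field, $\omega(\mathcal{O})$ denotes $\omega_{\mathcal{O}^*}(\mathcal{O})$, where for a subring $R$ of a field $F$ of characteristic $0$ and a finitely generated subgroup $\Gamma\subset F^*$: $\omega_{R,\Gamma}(\alpha)$ is the least $a_1$ over all representations $\alpha=a_1\nu_1+\dots+a_\ell\nu_\ell$ with pairwise distinct $\nu_i\in\Gamma\cap R$ and integers $a_1\geq\dots\geq a_\ell>0$ ($\omega_{R,\Gamma}(0)=0$, and $\infty$ if no representation exists), and $\omega_\Gamma(R)=\max_{\alpha\in R}\omega_{R,\Gamma}(\alpha)$ when the maximum exists. *)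

theory Defs
  imports Complex_Main "HOL-Computational_Algebra.Polynomial" "HOL-Library.Extended_Nat"
begin

definition Zadj :: "complex \<Rightarrow> complex set" where
  "Zadj \<alpha> = {poly (map_poly of_int p) \<alpha> | p :: int poly. True}"

definition ring_units :: "complex set \<Rightarrow> complex set" where
  "ring_units R = {u \<in> R. u \<noteq> 0 \<and> inverse u \<in> R}"

definition is_rep :: "complex set \<Rightarrow> complex set \<Rightarrow> complex \<Rightarrow> nat \<Rightarrow> (nat \<Rightarrow> nat) \<Rightarrow> (nat \<Rightarrow> complex) \<Rightarrow> bool" where
  "is_rep R \<Gamma> x l a \<nu> \<longleftrightarrow>
     (\<forall>i<l. a i > 0) \<and> (\<forall>i j. i \<le> j \<and> j < l \<longrightarrow> a j \<le> a i) \<and>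
     inj_on \<nu> {..<l} \<and> (\<forall>i<l. \<nu> i \<in> \<Gamma> \<inter> R) \<and>
     x = (\<Sum>i<l. of_nat (a i) * \<nu> i)"

text \<open>omega_{R,Gamma}(x): least a_1 over all representations; 0 for x = 0, infinity if none.\<close>
definition omega_RG :: "complex set \<Rightarrow> complex set \<Rightarrow> complex \<Rightarrow> enat" where
  "omega_RG R \<Gamma> x = (if x = 0 then 0 else
     Inf {enat (a 0) | l a \<nu>. l > 0 \<and> is_rep R \<Gamma> x l a \<nu>})"

text \<open>omega(O) = omega_{O^*}(O) = max of omega_{O,O^*} over O (as a supremum in enat;
  a bound by 2 implies the maximum exists).\<close>
definition omega_order :: "complex set \<Rightarrow> enat" where
  "omega_order R = Sup (omega_RG R (ring_units R) ` R)"

end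

(* With X = alpha and Y = -(1 + alpha), two units satisfying 1 + X + Y = 0, one has
   1 + X^3 + Y^3 = 3 X Y.  Hence 3 u = u/(X Y) + u X^2/Y + u Y^2/X for every unit u: three chips
   on the lattice point u = X^i Y^j can be fired to its three neighbours.  The layer 2 i + j changes
   by -3, 3 and 0, so occupied layers stay occupied; new layers are adjacent to old ones, so the
   fixed number of chips keeps the layers bounded, while the sum of the squared layers grows
   at each firing.  So the firing terminates, with at most two chips at each point.
   Distinct points give distinct units: a relation X^i Y^j = 1 or -1 also holds for the conjugate
   -1/(1 + alpha), and comparing logarithms gives (i^2 + i j + j^2) log|X| = 0 and likewise for Y;
   |X| = |Y| = 1 would force alpha^2 + alpha + 1 = 0. *)

theory Submission
  imports Defs "HOL-Library.Multiset"
begin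

section \<open>Termination of chip firing\<close>

text \<open>Trading three copies of \<open>w\<close> for \<open>f w\<close>, \<open>g w\<close> and
  \<open>k w\<close> keeps the number of chips and the sum of \<open>val\<close>, while the sum of
  the squares of \<open>h\<close> gains exactly \<open>2 * d\<^sup>2\<close>. That sum is bounded in
  advance, so the trades must stop.\<close>

lemma chip_firing:
  fixes h :: "'a \<Rightarrow> int" and val :: "'a \<Rightarrow> 'b::comm_ring_1"
  assumes d: "d > 0"
    and hf: "\<And>w. h (f w) = h w + d" and hg: "\<And>w. h (g w) = h w - d" and hk: "\<And>w. h (k w) = h w"
    and val: "\<And>w. val (f w) + val (g w) + val (k w) = 3 * val w"
  shows "\<exists>M'. (\<Sum>w\<in>#M'. val w) = (\<Sum>w\<in>#M. val w) \<and> (\<forall>w. count M' w \<le> 2)"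
proof -
  define B where "B = (\<Sum>w\<in>#M. \<bar>h w\<bar>)"
  define N where "N = size M"
  define L where "L K = h ` set_mset K" for K
  \<comment> \<open>At most \<open>N\<close> layers are occupied at any time, so the invariant of
    \<open>main\<close> bounds every squared height by \<open>Q\<close>.\<close>
  define Q where "Q = (B + d * int N)\<^sup>2"
  have finL: "finite (L K)" for K by (simp add: L_def)
  have cardL: "card (L K) \<le> size K" for K
  proof (induction K)
    case (add x K)
    then show ?case using card_insert_le_m1[of "Suc (size K)" "L K" "h x"]
      by (simp add: L_def card_insert_if)
  qed (simp add: L_def)
  \<comment> \<open>The invariant ties the spread of the chips to the number of occupied layers:
    that number never falls, and moving out to an empty layer increases it.\<close>
  have main: "\<exists>M'. (\<Sum>w\<in>#M'. val w) = (\<Sum>w\<in>#K. val w) \<and> (\<forall>w. count M' w \<le> 2)"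
    if "size K = N" "\<forall>w\<in>#K. \<bar>h w\<bar> \<le> B + d * int (card (L K))" for K
    using that
  proof (induction "nat (int N * Q - (\<Sum>w\<in>#K. (h w)\<^sup>2))" arbitrary: K rule: less_induct)
    case less
    show ?case
    proof (cases "\<forall>w. count K w \<le> 2")
      case False
      then obtain w where w: "count K w \<ge> 3" by (metis not_less_eq_eq numeral_2_eq_2 numeral_3_eq_3)
      have "replicate_mset 3 w \<subseteq># K" using w by (simp add: count_le_replicate_mset_subset_eq)
      then obtain R where "K = replicate_mset 3 w + R" by (metis subset_mset.le_iff_add)
      then have K: "K = {#w, w, w#} + R" by (simp add: numeral_3_eq_3)
      define K' where "K' = {#f w, g w, k w#} + R"
      \<comment> \<open>Three chips at \<open>w\<close> suffice for an occupied layer never to become empty.\<close>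
      have LK': "L K' = insert (h w + d) (insert (h w - d) (L K))"
        by (auto simp: K'_def L_def K hf hg hk)
      have bd: "\<bar>h v\<bar> \<le> B + d * int (card (L K'))" if "v \<in># K'" for v
      proof (cases "h v \<in> L K")
        case True
        have "card (L K) \<le> card (L K')" by (rule card_mono[OF finL]) (auto simp: LK')
        then have "d * int (card (L K)) \<le> d * int (card (L K'))" using d by simp
        moreover have "\<bar>h v\<bar> \<le> B + d * int (card (L K))" using True less.prems(2) by (auto simp: L_def)
        ultimately show ?thesis by linarith
      next
        case False
        have hv: "h v \<in> L K'" using that by (auto simp: L_def)
        then have "h v = h w + d \<or> h v = h w - d" using False LK' by auto
        moreover have "\<bar>h w\<bar> \<le> B + d * int (card (L K))" using less.prems(2) by (auto simp: K)
        ultimately have "\<bar>h v\<bar> \<le> B + d * int (card (L K)) + d" using d by auto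
        \<comment> \<open>The newly occupied layer raises the layer count, which pays for the extra
          \<open>d\<close>.\<close>
        moreover have "Suc (card (L K)) \<le> card (L K')"
        proof -
          have "card (insert (h v) (L K)) \<le> card (L K')"
            by (rule card_mono[OF finL]) (use hv in \<open>auto simp: LK'\<close>)
          then show ?thesis using False finL by simp
        qed
        then have "d * int (Suc (card (L K))) \<le> d * int (card (L K'))" using d
          by (intro mult_left_mono) auto
        ultimately show ?thesis by (simp add: algebra_simps)
      qed
      have sz: "size K' = N" using less.prems(1) by (simp add: K K'_def)
      \<comment> \<open>With this bound after the firing, the truncation in \<open>nat\<close>
        cannot hide the decrease of the measure.\<close>
      have "(\<Sum>v\<in>#K'. (h v)\<^sup>2) \<le> (\<Sum>v\<in>#K'. Q)"
      proof (rule sum_mset_mono)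
        fix v assume v: "v \<in># K'"
        have "d * int (card (L K')) \<le> d * int N" using cardL[of K'] sz d by simp
        then have "\<bar>h v\<bar> \<le> B + d * int N" using bd[OF v] by linarith
        then show "(h v)\<^sup>2 \<le> Q" unfolding Q_def by (metis abs_ge_zero power2_abs power_mono)
      qed
      then have up: "(\<Sum>v\<in>#K'. (h v)\<^sup>2) \<le> int N * Q" using sz by (simp add: sum_mset_constant)
      have "(\<Sum>v\<in>#K'. (h v)\<^sup>2) = (\<Sum>v\<in>#K. (h v)\<^sup>2) + 2 * d\<^sup>2"
        by (simp add: K K'_def hf hg hk power2_eq_square algebra_simps)
      moreover have "d\<^sup>2 > 0" using d by simp
      ultimately have "nat (int N * Q - (\<Sum>w\<in>#K'. (h w)\<^sup>2)) < nat (int N * Q - (\<Sum>w\<in>#K. (h w)\<^sup>2))"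
        using up by linarith
      from less.hyps[OF this sz] bd
      obtain M' where "(\<Sum>w\<in>#M'. val w) = (\<Sum>w\<in>#K'. val w)" "\<forall>w. count M' w \<le> 2" by blast
      moreover have "(\<Sum>w\<in>#K'. val w) = (\<Sum>w\<in>#K. val w)"
        using val[of w] by (simp add: K K'_def algebra_simps)
      ultimately show ?thesis by metis
    qed auto
  qed
  have "\<bar>h w\<bar> \<le> B" if "w \<in># M" for w
    using that unfolding B_def
  proof (induction M)
    case (add x K)
    have "0 \<le> (\<Sum>w\<in>#K. \<bar>h w\<bar>)" by (induction K) auto
    then show ?case using add by auto
  qed auto
  then have "\<forall>w\<in>#M. \<bar>h w\<bar> \<le> B + d * int (card (L M))" using d by (smt (verit) mult_nonneg_nonneg of_nat_0_le_iff)
  then show ?thesis using main[of M] by (simp add: N_def)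
qed

section \<open>From multisets to representations\<close>

lemma sum_mset_eq_sum_count:
  fixes val :: "'a \<Rightarrow> 'b::comm_semiring_1"
  assumes "finite A" "set_mset M \<subseteq> A"
  shows "(\<Sum>w\<in>#M. val w) = (\<Sum>w\<in>A. of_nat (count M w) * val w)"
  using assms(2)
proof (induction M)
  case (add x M)
  have "(\<Sum>w\<in>A. of_nat (count (add_mset x M) w) * val w)
      = (\<Sum>w\<in>A. (if w = x then val w else 0) + of_nat (count M w) * val w)"
    by (rule sum.cong) (auto simp: algebra_simps)
  also have "\<dots> = val x + (\<Sum>w\<in>A. of_nat (count M w) * val w)"
    using assms(1) add.prems by (simp add: sum.distrib)
  finally show ?case using add by simp
qed simp

text \<open>The distinct elements are listed by decreasing multiplicity, and the multiplicities
  become the coefficients. The leading coefficient is itself a multiplicity, so a bound on all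
  counts bounds it.\<close>

lemma multiset_is_rep:
  assumes inj: "inj_on val (set_mset M)" and G: "\<And>w. w \<in># M \<Longrightarrow> val w \<in> \<Gamma> \<inter> R"
    and ne: "M \<noteq> {#}"
  obtains l a \<nu> w where "l > 0" "is_rep R \<Gamma> (\<Sum>w\<in>#M. val w) l a \<nu>" "a 0 = count M w"
proof -
  obtain ys where ys: "set ys = set_mset M" "distinct ys"
    using finite_distinct_list[of "set_mset M"] by auto
  define xs where "xs = rev (sort_key (count M) ys)"
  have xs: "set xs = set_mset M" "distinct xs" using ys by (auto simp: xs_def)
  have sorted: "sorted (rev (map (count M) xs))" by (simp add: xs_def rev_map)
  let ?a = "\<lambda>i. count M (xs ! i)" and ?n = "\<lambda>i. val (xs ! i)"
  have len: "length xs > 0" using xs ne by auto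
  have "?a j \<le> ?a i" if "i \<le> j" "j < length xs" for i j
    using sorted_rev_nth_mono[OF sorted that(1)] that by simp
  moreover have "inj_on ?n {..<length xs}"
    using inj xs by (auto simp: inj_on_def nth_eq_iff_index_eq) (metis nth_eq_iff_index_eq nth_mem)
  moreover have "(\<Sum>w\<in>#M. val w) = (\<Sum>i<length xs. of_nat (?a i) * ?n i)"
  proof -
    have "(\<Sum>w\<in>#M. val w) = (\<Sum>w\<in>set_mset M. of_nat (count M w) * val w)"
      by (rule sum_mset_eq_sum_count) auto
    also have "\<dots> = (\<Sum>i<length xs. of_nat (?a i) * ?n i)"
      by (rule sum.reindex_bij_betw[symmetric, where h = "(!) xs", OF bij_betw_nth]) (use xs in auto)
    finally show ?thesis .
  qed
  moreover have "\<forall>i<length xs. ?a i > 0" using xs by (metis count_greater_zero_iff nth_mem)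
  moreover have "\<forall>i<length xs. ?n i \<in> \<Gamma> \<inter> R" using xs G by (metis nth_mem)
  ultimately have "is_rep R \<Gamma> (\<Sum>w\<in>#M. val w) (length xs) ?a ?n"
    unfolding is_rep_def by blast
  with len that show ?thesis by blast
qed

lemma omega_RG_le:
  assumes "l > 0" "is_rep R \<Gamma> x l a \<nu>" "a 0 \<le> n"
  shows "omega_RG R \<Gamma> x \<le> enat n"
proof (cases "x = 0")
  case False
  have "Inf {enat (a 0) | l a \<nu>. l > 0 \<and> is_rep R \<Gamma> x l a \<nu>} \<le> enat (a 0)"
    using assms by (intro Inf_lower) blast
  also have "\<dots> \<le> enat n" using assms by simp
  finally show ?thesis using False by (simp add: omega_RG_def)
qed (simp add: omega_RG_def zero_enat_def)

section \<open>Linear independence of the powers of a root\<close>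

text \<open>
  The form is the norm of \<open>b0 + b1 z + b2 z\<^sup>2\<close>, the determinant with rows \<open>b\<close>, \<open>c\<close>, \<open>d\<close>
  (multiplication by \<open>z\<close> takes \<open>b\<close> to \<open>c\<close> to \<open>d\<close>), where \<open>A = a - 1\<close>. It is anisotropic modulo 2
  since the cubic is irreducible there.
\<close>

lemma cubic_norm_form_parity:
  fixes A b0 b1 b2 :: int
  defines "c0 \<equiv> b2" and "c1 \<equiv> b0 + b2 * (A + 3)" and "c2 \<equiv> b1 + b2 * A"
  defines "d0 \<equiv> c2" and "d1 \<equiv> c0 + c2 * (A + 3)" and "d2 \<equiv> c1 + c2 * A"
  assumes "b0 * (c1 * d2 - c2 * d1) - c0 * (b1 * d2 - b2 * d1) + d0 * (b1 * c2 - b2 * c1) = 0"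
  shows "even b0 \<and> even b1 \<and> even b2"
proof -
  have "even (b0 * (c1 * d2 - c2 * d1) - c0 * (b1 * d2 - b2 * d1) + d0 * (b1 * c2 - b2 * c1))"
    using assms(7) by simp
  then show ?thesis unfolding assms(1-6) by (auto simp: even_add even_diff)
qed

text \<open>The equation is solved for the cube so that it serves as a reduction rule to degree 2;
  \<open>z\<close> is arbitrary so that conjugates are covered too.\<close>

definition cubic_root :: "int \<Rightarrow> complex \<Rightarrow> bool" where
  "cubic_root a z \<longleftrightarrow> z ^ 3 = (of_int a - 1) * z ^ 2 + (of_int a + 2) * z + 1"

text \<open>Infinite descent: a relation makes the norm form vanish, so all coefficients are even,
  and halving them gives a smaller relation.\<close>

lemma cubic_root_independent:
  assumes z: "cubic_root a z"
    and "of_int b0 + of_int b1 * z + of_int b2 * z ^ 2 = 0"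
  shows "b0 = 0 \<and> b1 = 0 \<and> b2 = 0"
  using assms(2)
proof (induction "nat (\<bar>b0\<bar> + \<bar>b1\<bar> + \<bar>b2\<bar>)" arbitrary: b0 b1 b2 rule: less_induct)
  case less
  define A where "A = a - 1"
  define c0 c1 c2 where "c0 = b2" and "c1 = b0 + b2 * (A + 3)" and "c2 = b1 + b2 * A"
  define d0 d1 d2 where "d0 = c2" and "d1 = c0 + c2 * (A + 3)" and "d2 = c1 + c2 * A"
  have z3: "z ^ 3 = of_int A * z ^ 2 + (of_int A + 3) * z + 1"
    using z by (simp add: cubic_root_def A_def)
  have b: "of_int b0 + of_int b1 * z + of_int b2 * z ^ 2 = 0" by (fact less.prems)
  have c: "of_int c0 + of_int c1 * z + of_int c2 * z ^ 2 = 0"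
  proof -
    have "of_int c0 + of_int c1 * z + of_int c2 * z ^ 2 =
      z * (of_int b0 + of_int b1 * z + of_int b2 * z ^ 2)
      - of_int b2 * (z ^ 3 - (of_int A * z ^ 2 + (of_int A + 3) * z + 1))"
      unfolding c0_def c1_def c2_def by (simp add: algebra_simps power2_eq_square power3_eq_cube)
    then show ?thesis using b z3 by simp
  qed
  have dd: "of_int d0 + of_int d1 * z + of_int d2 * z ^ 2 = 0"
  proof -
    have "of_int d0 + of_int d1 * z + of_int d2 * z ^ 2 =
      z * (of_int c0 + of_int c1 * z + of_int c2 * z ^ 2)
      - of_int c2 * (z ^ 3 - (of_int A * z ^ 2 + (of_int A + 3) * z + 1))"
      unfolding d0_def d1_def d2_def by (simp add: algebra_simps power2_eq_square power3_eq_cube)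
    then show ?thesis using c z3 by simp
  qed
  \<comment> \<open>The cofactors of the first column combine the three relations so that the terms
    in \<open>z\<close> and \<open>z ^ 2\<close> cancel and only the determinant remains.\<close>
  have "complex_of_int (b0 * (c1 * d2 - c2 * d1) - c0 * (b1 * d2 - b2 * d1) + d0 * (b1 * c2 - b2 * c1)) =
      of_int (c1 * d2 - c2 * d1) * (of_int b0 + of_int b1 * z + of_int b2 * z ^ 2)
    - of_int (b1 * d2 - b2 * d1) * (of_int c0 + of_int c1 * z + of_int c2 * z ^ 2)
    + of_int (b1 * c2 - b2 * c1) * (of_int d0 + of_int d1 * z + of_int d2 * z ^ 2)"
    by (simp add: algebra_simps)
  then have "b0 * (c1 * d2 - c2 * d1) - c0 * (b1 * d2 - b2 * d1) + d0 * (b1 * c2 - b2 * c1) = 0"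
    unfolding b c dd by (simp only: mult_zero_right of_int_eq_0_iff diff_self add_0)
  then have "even b0 \<and> even b1 \<and> even b2"
    unfolding c0_def c1_def c2_def d0_def d1_def d2_def by (rule cubic_norm_form_parity)
  then obtain e0 e1 e2 where e: "b0 = 2 * e0" "b1 = 2 * e1" "b2 = 2 * e2" by (auto elim!: evenE)
  have e0: "of_int e0 + of_int e1 * z + of_int e2 * z ^ 2 = 0"
  proof -
    have "2 * (of_int e0 + of_int e1 * z + of_int e2 * z ^ 2) = 0"
      using b by (simp add: e algebra_simps)
    then show ?thesis by (simp only: mult_eq_0_iff zero_neq_numeral[symmetric] simp_thms)
  qed
  show ?case
  proof (rule ccontr)
    assume n: "\<not> ?case"
    then have "nat (\<bar>e0\<bar> + \<bar>e1\<bar> + \<bar>e2\<bar>) < nat (\<bar>b0\<bar> + \<bar>b1\<bar> + \<bar>b2\<bar>)" by (auto simp: e)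
    from less.hyps[OF this e0] n show False by (auto simp: e)
  qed
qed


section \<open>Reduction modulo the cubic and conjugation\<close>

text \<open>The order of quantifiers matters: the same coordinates serve all roots at once, which
  lets relations pass from one root to another.\<close>

lemma cubic_root_coordinates:
  "\<exists>b0 b1 b2. \<forall>z. cubic_root a z \<longrightarrow>
     poly (map_poly of_int p) z = of_int b0 + of_int b1 * z + of_int b2 * z ^ 2"
proof (induction p)
  case 0
  show ?case by (intro exI[of _ 0]) simp
next
  case (pCons c p)
  then obtain b0 b1 b2 where b: "\<And>z. cubic_root a z \<Longrightarrow>
     poly (map_poly of_int p) z = of_int b0 + of_int b1 * z + of_int b2 * z ^ 2" by blast
  have "poly (map_poly of_int (pCons c p)) z =
      of_int (c + b2) + of_int (b0 + b2 * (a + 2)) * z + of_int (b1 + b2 * (a - 1)) * z ^ 2"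
    if z: "cubic_root a z" for z
  proof -
    have "poly (map_poly of_int (pCons c p)) z = of_int c + of_int b0 * z + of_int b1 * z ^ 2 + of_int b2 * z ^ 3"
      using pCons.hyps by (simp add: map_poly_pCons b[OF z] algebra_simps power2_eq_square power3_eq_cube)
    also have "z ^ 3 = (of_int a - 1) * z ^ 2 + (of_int a + 2) * z + 1"
      using z by (simp add: cubic_root_def)
    finally show ?thesis by (simp add: algebra_simps)
  qed
  then show ?case by blast
qed

text \<open>This stands in for the Galois action: the common coordinates vanish by independence at
  \<open>z\<close>, hence the value at \<open>z'\<close> is zero as well.\<close>

lemma cubic_root_transfer:
  assumes "cubic_root a z" "cubic_root a z'" "poly (map_poly of_int p) z = 0"
  shows "poly (map_poly of_int p) z' = 0"
proof -
  obtain b0 b1 b2 where b: "\<And>z. cubic_root a z \<Longrightarrow>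
     poly (map_poly of_int p) z = of_int b0 + of_int b1 * z + of_int b2 * z ^ 2"
    using cubic_root_coordinates[of a p] by blast
  have "b0 = 0 \<and> b1 = 0 \<and> b2 = 0"
    by (rule cubic_root_independent[OF assms(1)]) (use b[OF assms(1)] assms(3) in simp)
  then show ?thesis using b[OF assms(2)] by simp
qed

text \<open>The cubic takes the values -1 at 0 and 1 at -1, so neither is a root. These are Shanks'
  simplest cubics, whose roots are permuted by the map of order three that takes \<open>z\<close> to
  \<open>- inverse (1 + z)\<close>.\<close>

lemma cubic_root_conjugate:
  assumes z: "cubic_root a z"
  shows "z \<noteq> 0" "1 + z \<noteq> 0" "cubic_root a (- inverse (1 + z))"
proof -
  show z0: "z \<noteq> 0" using z by (auto simp: cubic_root_def)
  show z1: "1 + z \<noteq> 0"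
  proof
    assume "1 + z = 0"
    then have "z = -1" by (simp add: add_eq_0_iff)
    then show False using z by (simp add: cubic_root_def)
  qed
  define w where "w = inverse (1 + z)"
  have z': "z ^ 3 = (of_int a - 1) * z ^ 2 + (of_int a + 2) * z + 1"
    using z by (simp add: cubic_root_def)
  have w1: "w * (1 + z) = 1" using z1 by (simp add: w_def)
  have "- (w ^ 3) = (of_int a - 1) * w ^ 2 - (of_int a + 2) * w + 1"
    using z' w1 by algebra
  then show "cubic_root a (- inverse (1 + z))"
    by (simp add: cubic_root_def w_def[symmetric])
qed

lemma map_poly_of_int_mult:
  "map_poly of_int (p * q :: int poly) = (map_poly of_int p * map_poly of_int q :: 'a::comm_ring_1 poly)"
  by (rule poly_eqI) (simp add: coeff_map_poly coeff_mult)

lemma map_poly_of_int_power: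
  "map_poly of_int (p ^ n :: int poly) = (map_poly of_int p ^ n :: 'a::comm_ring_1 poly)"
  by (induction n) (simp_all add: map_poly_of_int_mult map_poly_1)

lemma map_poly_of_int_diff:
  "map_poly of_int (p - q :: int poly) = (map_poly of_int p - map_poly of_int q :: 'a::comm_ring_1 poly)"
  by (rule poly_eqI) (simp add: coeff_map_poly)

text \<open>With natural exponents on both sides the relation says that an integer polynomial
  vanishes at \<open>z\<close>, so it transfers to \<open>z'\<close>.\<close>

lemma cubic_root_unit_relation:
  assumes z: "cubic_root a z" and z': "cubic_root a z'"
    and "z ^ m * (1 + z) ^ n = of_int s * (z ^ m' * (1 + z) ^ n')"
  shows "z' ^ m * (1 + z') ^ n = of_int s * (z' ^ m' * (1 + z') ^ n')"
proof -
  define p :: "int poly" where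
    "p = [:0, 1:] ^ m * [:1, 1:] ^ n - [:s:] * ([:0, 1:] ^ m' * [:1, 1:] ^ n')"
  have p: "poly (map_poly of_int p) y = y ^ m * (1 + y) ^ n - of_int s * (y ^ m' * (1 + y) ^ n')" for y :: complex
    by (simp add: p_def map_poly_of_int_mult map_poly_of_int_power map_poly_of_int_diff map_poly_pCons
        poly_power del: mult_pCons_left)
  show ?thesis using cubic_root_transfer[OF z z', of p] assms(3) by (simp add: p)
qed

section \<open>Multiplicative independence of the units\<close>

text \<open>The unit circles around 0 and -1 meet only in the primitive cube roots of unity.\<close>

lemma norm_one_and_norm_succ_one:
  fixes z :: complex
  assumes "norm z = 1" "norm (1 + z) = 1"
  shows "z ^ 2 + z + 1 = 0"
proof -
  have 1: "(Re z)\<^sup>2 + (Im z)\<^sup>2 = 1" using assms(1) by (simp add: cmod_def)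
  have 2: "(1 + Re z)\<^sup>2 + (Im z)\<^sup>2 = 1" using assms(2) by (simp add: cmod_def)
  have r: "Re z = - 1 / 2" using 1 2 by (simp add: power2_eq_square algebra_simps)
  then have "(Im z)\<^sup>2 = 3 / 4" using 1 by (simp add: power2_eq_square)
  then show ?thesis using r by (simp add: complex_eq_iff power2_eq_square)
qed

lemma cubic_root_units_independent:
  assumes z: "cubic_root a z" and s: "s = 1 \<or> s = -1"
    and eq: "z powi i * (1 + z) powi j = of_int s"
  shows "i = 0 \<and> j = 0 \<and> s = 1"
proof -
  \<comment> \<open>Positive and negative parts of the exponents turn the relation into one between
    polynomials in \<open>z\<close>.\<close>
  define m m' n n' where "m = nat i" and "m' = nat (- i)" and "n = nat j" and "n' = nat (- j)"
  have i: "i = int m - int m'" and j: "j = int n - int n'" by (auto simp: m_def m'_def n_def n'_def)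
  define z' where "z' = - inverse (1 + z)"
  note nz = cubic_root_conjugate(1,2)[OF z]
  have z': "cubic_root a z'" unfolding z'_def by (rule cubic_root_conjugate(3)[OF z])
  have rel: "z ^ m * (1 + z) ^ n = of_int s * (z ^ m' * (1 + z) ^ n')"
    using eq nz by (simp add: i j power_int_diff field_simps)
  have log_rel: "of_int i * ln (norm y) + of_int j * ln (norm (1 + y)) = 0" if y: "cubic_root a y" for y
  proof -
    note ny = cubic_root_conjugate(1,2)[OF y]
    have "y ^ m * (1 + y) ^ n = of_int s * (y ^ m' * (1 + y) ^ n')"
      by (rule cubic_root_unit_relation[OF z y rel])
    then have "norm (y ^ m * (1 + y) ^ n) = norm (of_int s * (y ^ m' * (1 + y) ^ n'))" by simp
    then have "norm y ^ m * norm (1 + y) ^ n = norm y ^ m' * norm (1 + y) ^ n'"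
      using s by (auto simp: norm_mult norm_power)
    then have "ln (norm y ^ m * norm (1 + y) ^ n) = ln (norm y ^ m' * norm (1 + y) ^ n')" by simp
    then have "m * ln (norm y) + n * ln (norm (1 + y)) = m' * ln (norm y) + n' * ln (norm (1 + y))"
      using ny by (simp add: ln_mult ln_realpow)
    then show ?thesis by (simp add: i j algebra_simps)
  qed
  define A B where "A = ln (norm z)" and "B = ln (norm (1 + z))"
  have 1: "i * A + j * B = 0" using log_rel[OF z] by (simp add: A_def B_def)
  have "1 + z' = z / (1 + z)" using nz by (simp add: z'_def field_simps)
  then have "norm (1 + z') = norm z / norm (1 + z)" by (simp only: norm_divide)
  moreover have "norm z' = 1 / norm (1 + z)" by (simp add: z'_def norm_inverse divide_inverse)
  ultimately have 2: "- real_of_int i * B + j * (A - B) = 0"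
    using log_rel[OF z'] nz by (simp add: A_def B_def ln_div)
  \<comment> \<open>The two log relations are linear in \<open>A\<close> and \<open>B\<close>, with
    determinant \<open>i\<^sup>2 + i * j + j\<^sup>2\<close> up to sign. This form is positive
    definite.\<close>
  have q: "(i\<^sup>2 + i * j + j\<^sup>2) * A = 0" "(i\<^sup>2 + i * j + j\<^sup>2) * B = 0"
    using 1 2 by (simp_all add: algebra_simps power2_eq_square) algebra+
  have "i = 0 \<and> j = 0"
  proof (rule ccontr)
    assume "\<not> (i = 0 \<and> j = 0)"
    then have "i\<^sup>2 + j\<^sup>2 > 0" by (simp add: sum_power2_gt_zero_iff)
    moreover have "2 * (i\<^sup>2 + i * j + j\<^sup>2) = i\<^sup>2 + j\<^sup>2 + (i + j)\<^sup>2" by (simp add: power2_eq_square algebra_simps)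
    moreover have "(i + j)\<^sup>2 \<ge> 0" by simp
    ultimately have "2 * (i\<^sup>2 + i * j + j\<^sup>2) > 0" by (metis add_pos_nonneg)
    then have "i\<^sup>2 + i * j + j\<^sup>2 > 0" by (simp only: zero_less_mult_iff zero_less_numeral) simp
    then have "real_of_int (i\<^sup>2 + i * j + j\<^sup>2) \<noteq> 0" by (metis less_irrefl of_int_eq_0_iff)
    then have "A = 0" "B = 0" using q by auto
    then have "norm z = 1" "norm (1 + z) = 1" using nz by (auto simp: A_def B_def)
    then have "z ^ 2 + z + 1 = 0" by (rule norm_one_and_norm_succ_one)
    then show False using cubic_root_independent[OF z, of 1 1 1] by (simp add: algebra_simps)
  qed
  then show ?thesis using eq s by auto
qed

section \<open>Signed units and sums of them\<close>

text \<open>\<open>(s, i, j)\<close> encodes the unit \<open>\<plusminus>X\<^sup>iY\<^sup>j\<close> with \<open>X = z\<close> and \<open>Y = -(1 + z)\<close>.\<close>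

fun signed_unit :: "complex \<Rightarrow> bool \<times> int \<times> int \<Rightarrow> complex" where
  "signed_unit z (s, i, j) = (if s then 1 else - 1) * z powi i * (- (1 + z)) powi j"

lemma inj_signed_unit:
  assumes z: "cubic_root a z"
  shows "inj (signed_unit z)"
proof (rule injI)
  fix v w assume eq: "signed_unit z v = signed_unit z w"
  obtain s i j where v: "v = (s, i, j)" by (cases v)
  obtain s' i' j' where w: "w = (s', i', j')" by (cases w)
  note nz = cubic_root_conjugate(1,2)[OF z]
  \<comment> \<open>The sign left over in the quotient of the two units once
    \<open>- (1 + z)\<close> is replaced by \<open>1 + z\<close> in both.\<close>
  define t :: int where "t = (if (s = s') = even (j - j') then 1 else - 1)"
  have t: "t = 1 \<or> t = -1" by (simp add: t_def)
  have "z powi i * (1 + z) powi j = of_int t * (z powi i' * (1 + z) powi j')"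
    using eq unfolding v w signed_unit.simps power_int_minus_left t_def
    by (auto simp: minus_equation_iff split: if_splits)
  then have "z powi (i - i') * (1 + z) powi (j - j') = of_int t"
    using nz by (simp add: power_int_diff field_simps)
  then have "i - i' = 0 \<and> j - j' = 0 \<and> t = 1"
    using cubic_root_units_independent[OF z t] by blast
  then show "v = w" by (auto simp: v w t_def split: if_splits)
qed

lemma signed_unit_fire:
  assumes "z \<noteq> 0" "1 + z \<noteq> 0"
  shows "signed_unit z (s, i + 2, j - 1) + signed_unit z (s, i - 1, j - 1) + signed_unit z (s, i - 1, j + 2) =
    3 * signed_unit z (s, i, j)"
proof -
  define y where "y = - (1 + z)"
  have y: "y \<noteq> 0" using assms by (simp add: y_def add_eq_0_iff)
  have "1 + z + y = 0" by (simp add: y_def)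
  \<comment> \<open>\<open>1 + z + y\<close> is a factor of
    \<open>1 + z ^ 3 + y ^ 3 - 3 * z * y\<close>.\<close>
  then have "z ^ 3 + 1 + y ^ 3 = 3 * z * y" by algebra
  then have "z\<^sup>2 / y + 1 / (z * y) + y\<^sup>2 / z = 3"
    using assms y by (simp add: field_simps power2_eq_square power3_eq_cube)
  then have "z powi i * y powi j * (z\<^sup>2 / y + 1 / (z * y) + y\<^sup>2 / z) = 3 * (z powi i * y powi j)" by simp
  moreover have "signed_unit z (s, i + 2, j - 1) + signed_unit z (s, i - 1, j - 1) + signed_unit z (s, i - 1, j + 2) =
    (if s then 1 else - 1) * (z powi i * y powi j * (z\<^sup>2 / y + 1 / (z * y) + y\<^sup>2 / z))"
    using assms y unfolding signed_unit.simps y_def[symmetric]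
    by (simp add: power_int_add power_int_diff field_simps)
  ultimately show ?thesis by (simp add: y_def)
qed

lemma signed_unit_shift:
  assumes "z \<noteq> 0"
  shows "signed_unit z (s, i + 1, j) = z * signed_unit z (s, i, j)"
  using assms by (simp add: power_int_add)

lemma sum_signed_units_of_int:
  "\<exists>M. (\<Sum>w\<in>#M. signed_unit z w) = of_int c"
proof (cases "c \<ge> 0")
  case True
  then show ?thesis by (intro exI[of _ "replicate_mset (nat c) (True, 0, 0)"]) simp
next
  case False
  then show ?thesis by (intro exI[of _ "replicate_mset (nat (- c)) (False, 0, 0)"]) simp
qed

text \<open>Horner's rule: multiplication by \<open>z\<close> shifts the first exponent, and each
  coefficient is added as copies of 1 or -1.\<close>

lemma sum_signed_units_poly:
  assumes "z \<noteq> 0"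
  shows "\<exists>M. (\<Sum>w\<in>#M. signed_unit z w) = poly (map_poly of_int p) z"
proof (induction p)
  case 0
  show ?case by (intro exI[of _ "{#}"]) simp
next
  case (pCons c p)
  then obtain M where M: "(\<Sum>w\<in>#M. signed_unit z w) = poly (map_poly of_int p) z" by blast
  obtain K where K: "(\<Sum>w\<in>#K. signed_unit z w) = of_int c" using sum_signed_units_of_int by blast
  let ?M = "image_mset (\<lambda>(s, i, j). (s, i + 1, j)) M"
  have "(\<Sum>w\<in>#?M. signed_unit z w) = z * (\<Sum>w\<in>#M. signed_unit z w)"
    by (induction M) (auto simp: signed_unit_shift[OF assms] algebra_simps simp del: signed_unit.simps)
  then have "(\<Sum>w\<in>#K + ?M. signed_unit z w) = poly (map_poly of_int (pCons c p)) z"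
    using pCons.hyps by (simp add: K M map_poly_pCons)
  then show ?case by blast
qed

section \<open>Units of the order\<close>

lemma Zadj_mult: "x \<in> Zadj z \<Longrightarrow> y \<in> Zadj z \<Longrightarrow> x * y \<in> Zadj z"
  unfolding Zadj_def by (auto simp flip: poly_mult map_poly_of_int_mult)

lemma ZadjI: "poly (map_poly of_int p) z = x \<Longrightarrow> x \<in> Zadj z"
  unfolding Zadj_def by blast

lemma ring_units_Zadj_mult:
  "x \<in> ring_units (Zadj z) \<Longrightarrow> y \<in> ring_units (Zadj z) \<Longrightarrow> x * y \<in> ring_units (Zadj z)"
  by (auto simp: ring_units_def intro: Zadj_mult)

lemma ring_units_Zadj_inverse: "x \<in> ring_units (Zadj z) \<Longrightarrow> inverse x \<in> ring_units (Zadj z)"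
  by (auto simp: ring_units_def)

lemma one_in_ring_units_Zadj: "1 \<in> ring_units (Zadj z)"
  by (auto simp: ring_units_def intro!: ZadjI[of 1])

lemma ring_units_Zadj_powi: "x \<in> ring_units (Zadj z) \<Longrightarrow> x powi i \<in> ring_units (Zadj z)"
proof -
  assume x: "x \<in> ring_units (Zadj z)"
  have "x ^ n \<in> ring_units (Zadj z)" for n
    by (induction n) (use x in \<open>auto intro: ring_units_Zadj_mult one_in_ring_units_Zadj\<close>)
  then show ?thesis by (auto simp: power_int_def intro: ring_units_Zadj_inverse simp: power_inverse)
qed

lemma signed_unit_in_ring_units:
  assumes z: "cubic_root a z"
  shows "signed_unit z w \<in> ring_units (Zadj z)"
proof -
  obtain s i j where w: "w = (s, i, j)" by (cases w)
  note nz = cubic_root_conjugate(1,2)[OF z]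
  have z3: "z ^ 3 = (of_int a - 1) * z ^ 2 + (of_int a + 2) * z + 1" using z by (simp add: cubic_root_def)
  \<comment> \<open>Division of the cubic by \<open>X\<close> leaves remainder -1 and division by
    \<open>X + 1\<close> leaves remainder 1, so the quotients at \<open>z\<close> are the inverses
    of \<open>z\<close> and \<open>- (1 + z)\<close>.\<close>
  have "z * (z ^ 2 - (of_int a - 1) * z - (of_int a + 2)) = 1" using z3 by algebra
  then have iz: "inverse z = z ^ 2 - (of_int a - 1) * z - (of_int a + 2)" by (rule inverse_unique)
  have "(- (1 + z)) * (z ^ 2 - of_int a * z - 2) = 1" using z3 by algebra
  then have iz1: "inverse (- (1 + z)) = z ^ 2 - of_int a * z - 2" by (rule inverse_unique)
  have "z \<in> Zadj z" by (rule ZadjI[of "[:0, 1:]"]) (simp add: map_poly_pCons)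
  moreover have "inverse z \<in> Zadj z" unfolding iz
    by (rule ZadjI[of "[:- (a + 2), 1 - a, 1:]"]) (simp add: map_poly_pCons algebra_simps power2_eq_square)
  ultimately have 1: "z \<in> ring_units (Zadj z)" using nz by (simp add: ring_units_def)
  have "- (1 + z) \<in> Zadj z" by (rule ZadjI[of "[:- 1, - 1:]"]) (simp add: map_poly_pCons)
  moreover have "inverse (- (1 + z)) \<in> Zadj z" unfolding iz1
    by (rule ZadjI[of "[:- 2, - a, 1:]"]) (simp add: map_poly_pCons algebra_simps power2_eq_square)
  ultimately have 2: "- (1 + z) \<in> ring_units (Zadj z)"
    using nz unfolding ring_units_def by (metis (mono_tags, lifting) mem_Collect_eq neg_equal_0_iff_equal)
  have "- 1 \<in> Zadj z" by (rule ZadjI[of "[:- 1:]"]) (simp add: map_poly_pCons)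
  then have "- 1 \<in> ring_units (Zadj z)" by (simp add: ring_units_def)
  then have "(if s then 1 else - 1) \<in> ring_units (Zadj z)" using one_in_ring_units_Zadj by simp
  then show ?thesis unfolding w signed_unit.simps
    by (intro ring_units_Zadj_mult ring_units_Zadj_powi 1 2)
qed

theorem theorem2:
  fixes a :: int and \<alpha> :: complex
  assumes "\<alpha> ^ 3 - (of_int a - 1) * \<alpha> ^ 2 - (of_int a + 2) * \<alpha> - 1 = 0"
  shows "omega_order (Zadj \<alpha>) \<le> 2"
proof -
  have root: "cubic_root a \<alpha>" using assms by (simp add: cubic_root_def algebra_simps)
  note nz = cubic_root_conjugate(1,2)[OF root]
  let ?U = "ring_units (Zadj \<alpha>)" and ?u = "signed_unit \<alpha>"
  have "omega_RG (Zadj \<alpha>) ?U x \<le> enat 2" if x: "x \<in> Zadj \<alpha>" for x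
  proof (cases "x = 0")
    case False
    obtain p where "x = poly (map_poly of_int p) \<alpha>" using x by (auto simp: Zadj_def)
    then obtain K where K: "(\<Sum>w\<in>#K. ?u w) = x" using sum_signed_units_poly[OF nz(1)] by metis
    \<comment> \<open>With \<open>X\<close> = \<open>\<alpha>\<close> and \<open>Y\<close> =
      \<open>- (1 + \<alpha>)\<close>, the three moves multiply a unit by \<open>X^2/Y\<close>,
      \<open>1/(X*Y)\<close> and \<open>Y^2/X\<close>; the height \<open>2 * i + j\<close> changes
      by 3, -3 and 0.\<close>
    obtain M where M: "(\<Sum>w\<in>#M. ?u w) = x" "\<And>w. count M w \<le> 2"
      using chip_firing[of 3 "\<lambda>(s, i, j). 2 * i + j" "\<lambda>(s, i, j). (s, i + 2, j - 1)"
          "\<lambda>(s, i, j). (s, i - 1, j - 1)" "\<lambda>(s, i, j). (s, i - 1, j + 2)" ?u K]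
        signed_unit_fire[OF nz] unfolding K by (auto simp del: signed_unit.simps split: prod.splits)
    have "M \<noteq> {#}" using M(1) False by auto
    moreover have "inj_on ?u (set_mset M)" using inj_signed_unit[OF root] by (rule inj_on_subset) simp
    moreover have "?u w \<in> ?U \<inter> Zadj \<alpha>" for w
      using signed_unit_in_ring_units[OF root, of w] by (auto simp: ring_units_def)
    ultimately obtain l c \<nu> w where "l > 0" "is_rep (Zadj \<alpha>) ?U x l c \<nu>" "c 0 = count M w"
      using multiset_is_rep[of ?u M ?U "Zadj \<alpha>"] M(1) by metis
    then show ?thesis using M(2)[of w] by (intro omega_RG_le[of l _ _ x c \<nu>]) simp_all
  qed (simp add: omega_RG_def)
  then have "omega_order (Zadj \<alpha>) \<le> enat 2" unfolding omega_order_def by (auto intro: Sup_least)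
  then show ?thesis by (simp add: numeral_eq_enat)
qed

end
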